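(* There exists a constant $c>0$ such that for all $0 < \epsilon < 1/2$, $$M_{TFL}(\epsilon) \ge e^{(1/\epsilon)^{c\log(1/\epsilon)}}.$$
   Context: Given graphs $G$ and $F$, a map $\phi \colon V(G) \to V(F)$ is an $\epsilon$-approximate homomorphism if at most $\epsilon |V(G)|^2$ edges of $G$ do not map to edges of $F$ under $\phi$. For $\epsilon>0$, $M_{TFL}(\epsilon)$ denotes the smallest possible $M$ such that every triangle-free graph has an $\epsilon$-approximate homomorphism to a triangle-free graph on at most $M$ vertices (such an $M$ exists for every $\epsilon>0$).
   Formalization: The range 0 < ε < 1/2 is replaced by 0 < ε < 1/25, since the claim as written is false for larger ε: for example, for 1/4 ≤ ε < 1/2 Mantel's theorem gives M_TFL(ε) = 1, while the right-hand side exceeds e. *)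

theory Defs
  imports Complex_Main "HOL-Library.FuncSet" "HOL-Library.Extended_Real"
begin

definition simple_graph :: "'a set \<Rightarrow> 'a set set \<Rightarrow> bool" where
  "simple_graph V E \<longleftrightarrow> finite V \<and> (\<forall>e\<in>E. e \<subseteq> V \<and> card e = 2)"

text \<open>For a simple graph the three vertices below are automatically distinct,
  since edges have exactly two elements.\<close>

definition triangle_free :: "'a set set \<Rightarrow> bool" where
  "triangle_free E \<longleftrightarrow> \<not> (\<exists>x y z. {x, y} \<in> E \<and> {y, z} \<in> E \<and> {x, z} \<in> E)"

text \<open>Edges are unordered and each is counted once. An edge whose two ends are
  identified by the map has a singleton image, so it counts as not mapped to an edge.\<close>

definition approx_hom ::
  "real \<Rightarrow> 'a set \<Rightarrow> 'a set set \<Rightarrow> 'b set \<Rightarrow> 'b set set \<Rightarrow> ('a \<Rightarrow> 'b) \<Rightarrow> bool" where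
  "approx_hom \<epsilon> V E W F \<phi> \<longleftrightarrow>
     \<phi> \<in> V \<rightarrow> W \<and> real (card {e \<in> E. \<phi> ` e \<notin> F}) \<le> \<epsilon> * (real (card V))\<^sup>2"

text \<open>Every finite graph is isomorphic to one with vertices in the natural numbers, so
  quantifying over those covers all finite graphs.\<close>

definition TFL_bound :: "real \<Rightarrow> nat \<Rightarrow> bool" where
  "TFL_bound \<epsilon> M \<longleftrightarrow>
     (\<forall>(V :: nat set) E. simple_graph V E \<and> triangle_free E \<longrightarrow>
        (\<exists>(W :: nat set) F \<phi>. simple_graph W F \<and> triangle_free F \<and> card W \<le> M \<and>
           approx_hom \<epsilon> V E W F \<phi>))"

text \<open>The infimum is taken in the extended naturals, where a nonempty set attains its
  infimum, so this is the least admissible M. An admissible M exists for every positive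
  \<epsilon> (the triangle-free lemma); the value for an empty set is infinity.\<close>

definition M_TFL :: "real \<Rightarrow> enat" where
  "M_TFL \<epsilon> = Inf (enat ` {M. TFL_bound \<epsilon> M})"

text \<open>Range of \<epsilon> for lower bounds: a triangle-free graph on n vertices has at
  most n*n/4 edges, so M_TFL \<epsilon> is 1 for \<epsilon> at least 1/4, and a lower bound that exceeds
  e fails there. For \<epsilon> below 1/25, an approximate homomorphism from the 5-cycle maps all
  five edges to edges, hence M_TFL \<epsilon> is at least 3.\<close>

end

theory Submission
  imports Defs
begin

text \<open>
  The lower bound comes from triangle-free graphs that look, to any map with few values, like
  a union of many edge-disjoint triangles. Start with a Ruzsa-Szemeredi system \<open>T\<close>: triples on
  a vertex set \<open>P\<close> such that every edge lies in one triple and there are no triangles other than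
  the triples. Attach one bit to every triple, and replace each vertex by \<open>2 ^ card T\<close> copies, one for
  each assignment of bits, that is, for each subset of \<open>T\<close>. Two copies of distinct vertices of
  a triple \<open>t\<close> are adjacent iff they differ in bit \<open>t\<close>. A triangle in this blow-up would
  project to a triple \<open>t\<close> and would give three bits that are pairwise distinct, so the blow-up is
  triangle-free.

  Now let \<open>\<phi>\<close> map the blow-up to a triangle-free graph \<open>F\<close> on \<open>M\<close> vertices. It colours the cube over
  each vertex \<open>p\<close> with \<open>M\<close> colours. An average colour class has density at least about \<open>1 / M\<close> in the
  cube, so its points carry almost full entropy: the sum over all bits of the squared
  bias of the bit on the class is \<open>O(ln M)\<close> (\<open>sum_squared_biases_le\<close>,
  \<open>sum_bias_energy_le\<close>). If \<open>ln M\<close> is small compared with \<open>card T / card P\<close>, then for a typical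
  triple \<open>{p, q, r}\<close> its bit is nearly unbiased on typical classes, and hence about half
  of all pairs between a class over \<open>p\<close> and a class over \<open>q\<close> are edges, and likewise for the
  other two pairs. Since \<open>F\<close> has no triangle, each choice of three classes contains two between which
  all edges are lost (\<open>lost_pairs_of_triangle_ge\<close>). A constant proportion of all edges is
  lost, and the count gives the inequality of \<open>rs_system_lower_bound\<close>, which says in
  effect that \<open>M \<ge> exp (c * card T / card P)\<close> as long as \<open>\<epsilon>\<close> is a small multiple of
  \<open>card T / (card P)\<^sup>2\<close>.

  A set \<open>A\<close> of numbers below \<open>n\<close> without 3-term progressions gives a system with \<open>n * card A\<close> triples
  on \<open>9 * n\<close> vertices. Behrend's sets (\<open>behrend\<close>) have density at least \<open>1 / 16 ^ k\<close> below
  \<open>n = 2 ^ (k * (k + 1))\<close>. With \<open>k\<close> proportional to \<open>ln (1/\<epsilon>)\<close>, this makes \<open>ln M\<close> exponential in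
  \<open>(ln (1/\<epsilon>))\<^sup>2\<close>. If \<open>\<epsilon>\<close> is not small, then the 5-cycle shows that \<open>M \<ge> 3\<close>, which suffices for a small
  enough constant \<open>c\<close> because \<open>3\<close> exceeds \<open>exp 1\<close>.
\<close>

section \<open>Colourings of the cube have small total bias\<close>

text \<open>The conditional expectation of \<open>g\<close> on the colour class of \<open>S\<close>, for the uniform measure on \<open>Q\<close>.\<close>

definition colour_mean :: "'s set \<Rightarrow> ('s \<Rightarrow> 'w) \<Rightarrow> ('s \<Rightarrow> real) \<Rightarrow> 's \<Rightarrow> real" where
  "colour_mean Q f g S = (\<Sum>S' | S' \<in> Q \<and> f S' = f S. g S') / card {S' \<in> Q. f S' = f S}"

text \<open>The defining property of conditional expectation: a weight that depends on the colour only
  does not distinguish \<open>g\<close> from its conditional expectation.\<close>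

lemma sum_colour_mean:
  assumes "finite Q"
  shows "(\<Sum>S\<in>Q. h (f S) * colour_mean Q f g S) = (\<Sum>S\<in>Q. h (f S) * g S)"
proof -
  have "(\<Sum>S | S \<in> Q \<and> f S = y. h (f S) * colour_mean Q f g S) = 
        (\<Sum>S | S \<in> Q \<and> f S = y. h (f S) * g S)" if "y \<in> f ` Q" for y
  proof -
    have ne: "card {S' \<in> Q. f S' = y} \<noteq> 0"
      using that assms by auto
    have "(\<Sum>S | S \<in> Q \<and> f S = y. h (f S) * colour_mean Q f g S) =
        (\<Sum>S | S \<in> Q \<and> f S = y. h y * ((\<Sum>S' | S' \<in> Q \<and> f S' = y. g S') / card {S' \<in> Q. f S' = y}))"
      unfolding colour_mean_def by (intro sum.cong) auto
    also have "\<dots> = h y * (\<Sum>S' | S' \<in> Q \<and> f S' = y. g S')"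
      using ne by (simp add: sum_constant)
    also have "\<dots> = (\<Sum>S | S \<in> Q \<and> f S = y. h (f S) * g S)"
      unfolding sum_distrib_left by (intro sum.cong) auto
    finally show ?thesis .
  qed
  then show ?thesis
    unfolding sum.image_gen[OF assms, where g = f, where h = "\<lambda>S. h (f S) * colour_mean Q f g S"]
      sum.image_gen[OF assms, where g = f, where h = "\<lambda>S. h (f S) * g S"]
    by (rule sum.cong[OF refl])
qed

definition sign :: "'t \<Rightarrow> 't set \<Rightarrow> real" where
  "sign t S = (if t \<in> S then 1 else -1)"

lemma cosh_le_exp_square:
  fixes x :: real
  assumes "\<bar>x\<bar> \<le> 1/2"
  shows "exp x + exp (- x) \<le> 2 * exp (x\<^sup>2)"
proof -
  have main: "exp x + exp (- x) \<le> 2 * exp (x\<^sup>2)" if x: "0 \<le> x" "x \<le> 1/2" for x :: real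
  proof -
    have "exp (- x) = 1 / exp x"
      by (simp add: exp_minus field_simps)
    also have "\<dots> \<le> 1 / (1 + x)"
      using x exp_ge_add_one_self[of x] by (intro divide_left_mono) (auto simp del: exp_ge_add_one_self)
    also have "\<dots> \<le> 1 - x + x\<^sup>2"
      using x by (simp add: divide_simps) (simp add: algebra_simps power2_eq_square)
    finally have "exp (- x) \<le> 1 - x + x\<^sup>2" .
    moreover have "exp x \<le> 1 + x + x\<^sup>2"
      using exp_bound[of x] x by simp
    moreover have "1 + x\<^sup>2 \<le> exp (x\<^sup>2)"
      by (rule exp_ge_add_one_self)
    ultimately show ?thesis by linarith
  qed
  show ?thesis
  proof (cases "x \<ge> 0")
    case True
    then show ?thesis using main[of x] assms by simp
  next
    case False
    then show ?thesis using main[of "-x"] assms by (simp add: add.commute)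
  qed
qed

text \<open>The bits of a uniform point of the cube are independent, so the exponential moment factorizes.\<close>

lemma sum_exp_signs:
  assumes "finite T"
  shows "(\<Sum>S\<in>Pow T. exp (\<Sum>t\<in>T. l t * sign t S)) = (\<Prod>t\<in>T. exp (l t) + exp (- l t))"
proof -
  have "exp (\<Sum>t\<in>T. l t * sign t S) = (\<Prod>t\<in>S. exp (l t)) * (\<Prod>t\<in>T - S. exp (- l t))"
    if "S \<in> Pow T" for S
  proof -
    have "exp (\<Sum>t\<in>T. l t * sign t S) = (\<Prod>t\<in>T. exp (l t * sign t S))"
      by (rule exp_sum[OF assms])
    also have "\<dots> = (\<Prod>t\<in>T - S. exp (l t * sign t S)) * (\<Prod>t\<in>S. exp (l t * sign t S))"
      using that assms by (intro prod.subset_diff) auto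
    also have "(\<Prod>t\<in>T - S. exp (l t * sign t S)) = (\<Prod>t\<in>T - S. exp (- l t))"
      by (intro prod.cong) (auto simp: sign_def)
    also have "(\<Prod>t\<in>S. exp (l t * sign t S)) = (\<Prod>t\<in>S. exp (l t))"
      by (intro prod.cong) (auto simp: sign_def)
    finally show ?thesis by (simp add: mult.commute)
  qed
  then have "(\<Sum>S\<in>Pow T. exp (\<Sum>t\<in>T. l t * sign t S)) =
      (\<Sum>S\<in>Pow T. (\<Prod>t\<in>S. exp (l t)) * (\<Prod>t\<in>T - S. exp (- l t)))"
    by (intro sum.cong) auto
  also have "\<dots> = (\<Prod>t\<in>T. exp (l t) + exp (- l t))"
    by (rule prod_add[OF assms, symmetric])
  finally show ?thesis .
qed

text \<open>Jensen's inequality for \<open>exp\<close>, obtained by adding up the tangent inequalities at the mean.\<close>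

lemma exp_mean_le:
  fixes u :: "'s \<Rightarrow> real"
  assumes "finite A"
  shows "card A * exp (sum u A / card A) \<le> (\<Sum>S\<in>A. exp (u S))"
proof (cases "A = {}")
  case False
  define m where "m = sum u A / card A"
  have cA: "real (card A) > 0" using False assms by (simp add: card_gt_0_iff)
  have "(\<Sum>S\<in>A. exp m * (1 + (u S - m))) = exp m * (card A + (sum u A - card A * m))"
    by (simp add: sum_distrib_left[symmetric] sum.distrib sum_subtractf)
  also have "\<dots> = card A * exp m"
    using cA by (simp add: m_def)
  finally have "card A * exp m = (\<Sum>S\<in>A. exp m * (1 + (u S - m)))" ..
  also have "\<dots> \<le> (\<Sum>S\<in>A. exp m * exp (u S - m))"
    by (intro sum_mono mult_left_mono exp_ge_add_one_self) auto
  also have "\<dots> = (\<Sum>S\<in>A. exp (u S))"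
    by (simp add: exp_add[symmetric])
  finally show ?thesis by (simp add: m_def)
qed simp

text \<open>A large subset of the cube cannot be biased in many bits. This is an entropy estimate,
  proved here with exponential moments: let \<open>d t\<close> be the bias of bit \<open>t\<close> on \<open>A\<close> and consider the linear
  form \<open>\<Sum>t\<in>T. d t / 2 * sign t S\<close>. Its mean over \<open>A\<close> is half the sum of the squared biases. By Jensen's
  inequality the exponential of this mean is at most the mean of the exponentials over \<open>A\<close>. Extending
  the latter from \<open>A\<close> to the whole cube costs a factor \<open>2 ^ card T / card A\<close>, and on the cube the
  exponential moment is at most the exponential of a quarter of the sum of the squared biases.
  Taking logarithms gives the claim. The coefficient \<open>d t / 2\<close>, and not \<open>d t\<close>, leaves a positive
  difference between the half and the quarter.\<close>

lemma sum_squared_biases_le: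
  assumes T: "finite T" and A: "A \<subseteq> Pow T" "A \<noteq> {}"
  shows "(\<Sum>t\<in>T. ((\<Sum>S\<in>A. sign t S) / card A)\<^sup>2) \<le> 4 * ln (2 ^ card T / card A)"
proof -
  define d where "d t = (\<Sum>S\<in>A. sign t S) / card A" for t
  have fA: "finite A" using T A finite_subset by auto
  have cA: "real (card A) > 0" using A fA by (simp add: card_gt_0_iff)
  have d1: "\<bar>d t\<bar> \<le> 1" for t
  proof -
    have "\<bar>\<Sum>S\<in>A. sign t S\<bar> \<le> (\<Sum>S\<in>A. \<bar>sign t S\<bar>)" by (rule sum_abs)
    also have "\<dots> = card A" by (simp add: sign_def if_distrib cong: if_cong)
    finally show ?thesis using cA by (simp add: d_def)
  qed
  have mean: "(\<Sum>S\<in>A. (\<Sum>t\<in>T. d t / 2 * sign t S)) / card A = (\<Sum>t\<in>T. (d t)\<^sup>2) / 2"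
  proof -
    have "(\<Sum>S\<in>A. (\<Sum>t\<in>T. d t / 2 * sign t S)) = (\<Sum>t\<in>T. d t / 2 * (\<Sum>S\<in>A. sign t S))"
      by (subst sum.swap) (simp add: sum_distrib_left)
    also have "\<dots> = (\<Sum>t\<in>T. card A * ((d t)\<^sup>2 / 2))"
      using cA by (intro sum.cong) (auto simp: d_def power2_eq_square)
    also have "\<dots> = card A * ((\<Sum>t\<in>T. (d t)\<^sup>2) / 2)"
      by (simp add: sum_distrib_left sum_divide_distrib)
    finally show ?thesis using cA by simp
  qed
  have "card A * exp ((\<Sum>t\<in>T. (d t)\<^sup>2) / 2) \<le> (\<Sum>S\<in>A. exp (\<Sum>t\<in>T. d t / 2 * sign t S))"
    using exp_mean_le[OF fA, of "\<lambda>S. \<Sum>t\<in>T. d t / 2 * sign t S"] unfolding mean .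
  also have "\<dots> \<le> (\<Sum>S\<in>Pow T. exp (\<Sum>t\<in>T. d t / 2 * sign t S))"
    using T A by (intro sum_mono2) auto
  also have "\<dots> = (\<Prod>t\<in>T. exp (d t / 2) + exp (- (d t / 2)))"
    by (rule sum_exp_signs[OF T])
  also have "\<dots> \<le> (\<Prod>t\<in>T. 2 * exp ((d t / 2)\<^sup>2))"
    using d1 by (intro prod_mono conjI cosh_le_exp_square) (auto intro: add_nonneg_nonneg)
  also have "\<dots> = 2 ^ card T * exp ((\<Sum>t\<in>T. (d t)\<^sup>2) / 4)"
    using T by (simp add: prod.distrib exp_sum[symmetric] power_divide sum_divide_distrib)
  finally have le: "card A * exp ((\<Sum>t\<in>T. (d t)\<^sup>2) / 2) \<le> 2 ^ card T * exp ((\<Sum>t\<in>T. (d t)\<^sup>2) / 4)" .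
  have "ln (card A) + (\<Sum>t\<in>T. (d t)\<^sup>2) / 2 = ln (card A * exp ((\<Sum>t\<in>T. (d t)\<^sup>2) / 2))"
    using cA by (simp add: ln_mult)
  also have "\<dots> \<le> ln (2 ^ card T * exp ((\<Sum>t\<in>T. (d t)\<^sup>2) / 4))"
    using le cA by (intro ln_mono) auto
  also have "\<dots> = ln (2 ^ card T) + (\<Sum>t\<in>T. (d t)\<^sup>2) / 4"
    by (simp add: ln_mult)
  finally have "ln (card A) + (\<Sum>t\<in>T. (d t)\<^sup>2) / 2 \<le> ln (2 ^ card T) + (\<Sum>t\<in>T. (d t)\<^sup>2) / 4" .
  moreover have "e \<le> 4 * (y - x)" if "x + e / 2 \<le> y + e / 4" for x y e :: real
    using that by (simp add: field_simps)
  ultimately have "(\<Sum>t\<in>T. (d t)\<^sup>2) \<le> 4 * (ln (2 ^ card T) - ln (card A))" by blast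
  also have "\<dots> = 4 * ln (2 ^ card T / card A)"
    using cA by (simp add: ln_div)
  finally show ?thesis by (simp add: d_def)
qed

text \<open>The entropy of a random variable with at most \<open>M\<close> values is at most \<open>ln M\<close>. The proof
  uses \<open>ln x \<le> x - 1\<close> for \<open>x\<close> the ratio of \<open>1 / M\<close> and the density of the class; the sum of the
  reciprocals of the class sizes over all points is the number of classes.\<close>

lemma sum_ln_class_size_le:
  assumes Q: "finite Q" "Q \<noteq> {}" and W: "card (f ` Q) \<le> M"
  shows "(\<Sum>S\<in>Q. ln (card Q / card {S' \<in> Q. f S' = f S})) \<le> card Q * ln M"
proof -
  define n where "n y = card {S' \<in> Q. f S' = y}" for y
  have cQ: "real (card Q) > 0" using Q by (simp add: card_gt_0_iff)
  have n: "real (n (f S)) > 0" if "S \<in> Q" for S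
    using that Q by (auto simp: n_def card_gt_0_iff)
  have "card (f ` Q) > 0" using Q by (simp add: card_gt_0_iff)
  then have M: "real M > 0" using W by simp
  have "(\<Sum>S\<in>Q. 1 / n (f S)) = (\<Sum>y\<in>f ` Q. \<Sum>S | S \<in> Q \<and> f S = y. 1 / n (f S))"
    by (rule sum.image_gen[OF Q(1)])
  also have "\<dots> = (\<Sum>y\<in>f ` Q. 1)"
  proof (intro sum.cong refl)
    fix y assume "y \<in> f ` Q"
    then have "real (n y) > 0" using n by auto
    have "(\<Sum>S | S \<in> Q \<and> f S = y. 1 / n (f S)) = (\<Sum>S | S \<in> Q \<and> f S = y. 1 / n y)"
      by (intro sum.cong) auto
    also have "\<dots> = 1" using \<open>real (n y) > 0\<close> by (simp add: n_def)
    finally show "(\<Sum>S | S \<in> Q \<and> f S = y. 1 / n (f S)) = 1" .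
  qed
  finally have inv: "(\<Sum>S\<in>Q. 1 / n (f S)) \<le> M" using W by simp
  have "(\<Sum>S\<in>Q. ln (card Q / n (f S))) \<le> (\<Sum>S\<in>Q. ln M + (card Q / M * (1 / n (f S)) - 1))"
  proof (intro sum_mono)
    fix S assume S: "S \<in> Q"
    define x where "x = card Q / M * (1 / n (f S))"
    have x: "x > 0" using n[OF S] cQ M by (simp add: x_def)
    have "card Q / n (f S) = M * x" using M by (simp add: x_def)
    then have "ln (card Q / n (f S)) = ln M + ln x"
      using x M by (simp add: ln_mult)
    also have "\<dots> \<le> ln M + (x - 1)" using ln_le_minus_one[OF x] by simp
    finally show "ln (card Q / n (f S)) \<le> ln M + (card Q / M * (1 / n (f S)) - 1)"
      by (simp add: x_def)
  qed
  also have "\<dots> = card Q * ln M + (card Q / M * (\<Sum>S\<in>Q. 1 / n (f S)) - card Q)"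
    by (simp add: sum.distrib sum_subtractf sum_distrib_left)
  also have "\<dots> \<le> card Q * ln M + (card Q / M * M - card Q)"
    using inv M by (intro add_left_mono diff_right_mono mult_left_mono) auto
  also have "\<dots> = card Q * ln M" using M by simp
  finally show ?thesis by (simp add: n_def)
qed

definition bias_energy :: "'t set \<Rightarrow> ('t set \<Rightarrow> 'w) \<Rightarrow> 't \<Rightarrow> real" where
  "bias_energy T f t = (\<Sum>S\<in>Pow T. (colour_mean (Pow T) f (sign t) S)\<^sup>2)"

lemma sum_bias_energy_le:
  assumes T: "finite T" and W: "card (f ` Pow T) \<le> M"
  shows "(\<Sum>t\<in>T. bias_energy T f t) \<le> 4 * 2 ^ card T * ln M"
proof -
  have "(\<Sum>t\<in>T. bias_energy T f t) =
      (\<Sum>S\<in>Pow T. \<Sum>t\<in>T. (colour_mean (Pow T) f (sign t) S)\<^sup>2)"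
    unfolding bias_energy_def by (rule sum.swap)
  also have "\<dots> \<le> (\<Sum>S\<in>Pow T. 4 * ln (card (Pow T) / card {S' \<in> Pow T. f S' = f S}))"
  proof (intro sum_mono)
    fix S assume "S \<in> Pow T"
    then show "(\<Sum>t\<in>T. (colour_mean (Pow T) f (sign t) S)\<^sup>2)
        \<le> 4 * ln (card (Pow T) / card {S' \<in> Pow T. f S' = f S})"
      using sum_squared_biases_le[OF T, of "{S' \<in> Pow T. f S' = f S}"] T
      by (auto simp: colour_mean_def card_Pow)
  qed
  also have "\<dots> = 4 * (\<Sum>S\<in>Pow T. ln (card (Pow T) / card {S' \<in> Pow T. f S' = f S}))"
    by (simp add: sum_distrib_left)
  also have "\<dots> \<le> 4 * (card (Pow T) * ln M)"
    using T W by (intro mult_left_mono sum_ln_class_size_le) auto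
  finally show ?thesis using T by (simp add: card_Pow)
qed

section \<open>Edges that are lost in one triangle\<close>

definition lost_pairs ::
  "'t set \<Rightarrow> 't \<Rightarrow> 'w set set \<Rightarrow> ('t set \<Rightarrow> 'w) \<Rightarrow> ('t set \<Rightarrow> 'w) \<Rightarrow> ('t set \<times> 't set) set" where
  "lost_pairs T t F f g =
     {(S, S') \<in> Pow T \<times> Pow T. (t \<in> S) \<noteq> (t \<in> S') \<and> {f S, g S'} \<notin> F}"

text \<open>Whether the image of a pair is an edge depends only on the colours of its two ends. The indicator
  that bit \<open>t\<close> differs is \<open>(1 - sign t S * sign t S') / 2\<close>, and in the sum over all pairs each sign may
  be replaced by its conditional expectation.\<close>

lemma card_lost_pairs:
  assumes T: "finite T"
  shows "real (card (lost_pairs T t F f g)) =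
    (\<Sum>S\<in>Pow T. \<Sum>S'\<in>Pow T. of_bool ({f S, g S'} \<notin> F) *
       (1 - colour_mean (Pow T) f (sign t) S * colour_mean (Pow T) g (sign t) S') / 2)"
    (is "_ = ?rhs")
proof -
  let ?Q = "Pow T" and ?k = "\<lambda>S S'. of_bool ({f S, g S'} \<notin> F) :: real"
  let ?a = "colour_mean ?Q f (sign t)" and ?b = "colour_mean ?Q g (sign t)"
  have Q: "finite ?Q" using T by simp
  have "real (card (lost_pairs T t F f g)) = (\<Sum>x\<in>?Q \<times> ?Q. of_bool (x \<in> lost_pairs T t F f g))"
  proof -
    have "?Q \<times> ?Q \<inter> lost_pairs T t F f g = lost_pairs T t F f g"
      by (auto simp: lost_pairs_def)
    then show ?thesis using Q by (simp add: sum_of_bool_eq Collect_conj_eq Int_def[symmetric])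
  qed
  also have "\<dots> = (\<Sum>S\<in>?Q. \<Sum>S'\<in>?Q. of_bool ((S, S') \<in> lost_pairs T t F f g))"
    by (simp add: sum.cartesian_product split_def)
  also have "\<dots> = (\<Sum>S\<in>?Q. \<Sum>S'\<in>?Q. ?k S S' * (1 - sign t S * sign t S') / 2)"
    by (intro sum.cong) (auto simp: lost_pairs_def sign_def)
  also have "\<dots> = (\<Sum>S\<in>?Q. \<Sum>S'\<in>?Q. ?k S S' / 2 - sign t S * (?k S S' * sign t S') / 2)"
    by (intro sum.cong refl) (simp add: field_simps)
  also have "\<dots> = (\<Sum>S\<in>?Q. \<Sum>S'\<in>?Q. ?k S S') / 2
      - (\<Sum>S\<in>?Q. sign t S * (\<Sum>S'\<in>?Q. ?k S S' * sign t S')) / 2"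
    by (simp only: sum_subtractf sum_divide_distrib sum_distrib_left)
  also have "(\<Sum>S\<in>?Q. sign t S * (\<Sum>S'\<in>?Q. ?k S S' * sign t S')) =
      (\<Sum>S\<in>?Q. sign t S * (\<Sum>S'\<in>?Q. ?k S S' * ?b S'))"
    by (intro sum.cong refl arg_cong2[where f = "(*)"]
        sum_colour_mean[OF Q, where f = g, symmetric])
  also have "\<dots> = (\<Sum>S'\<in>?Q. ?b S' * (\<Sum>S\<in>?Q. ?k S S' * sign t S))"
    unfolding sum_distrib_left by (subst sum.swap) (simp add: mult_ac)
  also have "\<dots> = (\<Sum>S'\<in>?Q. ?b S' * (\<Sum>S\<in>?Q. ?k S S' * ?a S))"
    by (intro sum.cong refl arg_cong2[where f = "(*)"]
        sum_colour_mean[OF Q, where f = f, symmetric])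
  also have "\<dots> = (\<Sum>S\<in>?Q. \<Sum>S'\<in>?Q. ?k S S' * (?a S * ?b S'))"
    unfolding sum_distrib_left by (subst sum.swap) (simp add: mult_ac)
  also have "(\<Sum>S\<in>?Q. \<Sum>S'\<in>?Q. ?k S S') / 2 - \<dots> / 2 = ?rhs"
    by (simp add: right_diff_distrib diff_divide_distrib sum_subtractf sum_divide_distrib)
  finally show ?thesis .
qed

lemma abs_colour_mean_sign_le: "\<bar>colour_mean Q f (sign t) S\<bar> \<le> 1"
proof -
  have "\<bar>\<Sum>S' | S' \<in> Q \<and> f S' = f S. sign t S'\<bar> \<le> (\<Sum>S' | S' \<in> Q \<and> f S' = f S. \<bar>sign t S'\<bar>)"
    by (rule sum_abs)
  also have "\<dots> = card {S' \<in> Q. f S' = f S}"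
    by (simp add: sign_def if_distrib cong: if_cong)
  finally show ?thesis
    by (cases "card {S' \<in> Q. f S' = f S} = 0") (simp_all add: colour_mean_def)
qed

text \<open>All three summands are nonnegative, and one that is present is already
  large enough, since \<open>a * b \<le> (a\<^sup>2 + b\<^sup>2) / 2\<close>.\<close>

lemma triangle_lost_weight:
  fixes a b c :: real
  assumes abc: "\<bar>a\<bar> \<le> 1" "\<bar>b\<bar> \<le> 1" "\<bar>c\<bar> \<le> 1" and "P \<or> Q \<or> R"
  shows "1/2 - (a\<^sup>2 + b\<^sup>2 + c\<^sup>2) / 2 \<le>
    of_bool P * (1 - a * b) / 2 + of_bool Q * (1 - b * c) / 2 + of_bool R * (1 - a * c) / 2"
proof -
  have nonneg: "0 \<le> of_bool B * (1 - x * y) / 2" if "\<bar>x\<bar> \<le> 1" "\<bar>y\<bar> \<le> 1" for x y :: real and B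
  proof -
    have "\<bar>x * y\<bar> \<le> 1 * 1"
      unfolding abs_mult using that by (intro mult_mono) auto
    then show ?thesis by (cases B) auto
  qed
  have large: "1/2 - (a\<^sup>2 + b\<^sup>2 + c\<^sup>2) / 2 \<le> of_bool B * (1 - x * y) / 2"
    if "B" "x\<^sup>2 + y\<^sup>2 \<le> a\<^sup>2 + b\<^sup>2 + c\<^sup>2" for x y and B
  proof -
    have "2 * (x * y) \<le> x\<^sup>2 + y\<^sup>2"
      using sum_squares_bound[of x y] by (simp add: mult.assoc)
    moreover have "0 \<le> x\<^sup>2 + y\<^sup>2" by simp
    ultimately have "x * y \<le> a\<^sup>2 + b\<^sup>2 + c\<^sup>2" using that(2) by linarith
    then show ?thesis using that(1) by (simp add: field_simps)
  qed
  define p q r where "p = of_bool P * (1 - a * b) / 2" and "q = of_bool Q * (1 - b * c) / 2"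
    and "r = of_bool R * (1 - a * c) / 2"
  have "0 \<le> p" "0 \<le> q" "0 \<le> r"
    unfolding p_def q_def r_def by (intro nonneg abc)+
  moreover have "1/2 - (a\<^sup>2 + b\<^sup>2 + c\<^sup>2) / 2 \<le> p \<or> 1/2 - (a\<^sup>2 + b\<^sup>2 + c\<^sup>2) / 2 \<le> q
      \<or> 1/2 - (a\<^sup>2 + b\<^sup>2 + c\<^sup>2) / 2 \<le> r"
    using assms(4) large[of P a b] large[of Q b c] large[of R a c]
    unfolding p_def q_def r_def by fastforce
  ultimately show ?thesis
    unfolding p_def[symmetric] q_def[symmetric] r_def[symmetric] by linarith
qed

text \<open>Let \<open>f\<close>, \<open>g\<close>, \<open>h\<close> be the colourings of the cubes over the three vertices of a triple. For each
  choice of three points, one from each cube, the three colours do not span a triangle of \<open>F\<close>, so at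
  least one of the three pairs of colours is lost. Without any bias, this is
  a loss of weight \<open>1/2\<close> for each choice; the biases reduce it by at most half the sum of
  their squares. Summing over the \<open>8 ^ card T\<close> choices counts each lost pair \<open>2 ^ card T\<close> times.\<close>

lemma lost_pairs_of_triangle_ge:
  assumes T: "finite T" and F: "triangle_free F"
  shows "4 ^ card T / 2
      - 2 ^ card T / 2 * (bias_energy T f t + bias_energy T g t + bias_energy T h t)
    \<le> card (lost_pairs T t F f g) + card (lost_pairs T t F g h) + card (lost_pairs T t F f h)"
proof -
  let ?Q = "Pow T" and ?D = "2 ^ card T :: real"
  define a b c where "a = colour_mean ?Q f (sign t)" and "b = colour_mean ?Q g (sign t)"
    and "c = colour_mean ?Q h (sign t)"
  have cQ: "real (card ?Q) = ?D" using T by (simp add: card_Pow)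
  define X where "X S1 S2 = of_bool ({f S1, g S2} \<notin> F) * (1 - a S1 * b S2) / 2" for S1 S2
  define Y where "Y S2 S3 = of_bool ({g S2, h S3} \<notin> F) * (1 - b S2 * c S3) / 2" for S2 S3
  define Z where "Z S1 S3 = of_bool ({f S1, h S3} \<notin> F) * (1 - a S1 * c S3) / 2" for S1 S3
  have "(\<Sum>S1\<in>?Q. \<Sum>S2\<in>?Q. \<Sum>S3\<in>?Q. 1/2 - ((a S1)\<^sup>2 + (b S2)\<^sup>2 + (c S3)\<^sup>2) / 2)
    \<le> (\<Sum>S1\<in>?Q. \<Sum>S2\<in>?Q. \<Sum>S3\<in>?Q. X S1 S2 + Y S2 S3 + Z S1 S3)"
  proof (intro sum_mono)
    fix S1 S2 S3
    have "{f S1, g S2} \<notin> F \<or> {g S2, h S3} \<notin> F \<or> {f S1, h S3} \<notin> F"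
      using F unfolding triangle_free_def by blast
    then show "1/2 - ((a S1)\<^sup>2 + (b S2)\<^sup>2 + (c S3)\<^sup>2) / 2 \<le> X S1 S2 + Y S2 S3 + Z S1 S3"
      unfolding X_def Y_def Z_def a_def b_def c_def
      by (intro triangle_lost_weight abs_colour_mean_sign_le)
  qed
  also have "\<dots> = ?D * (\<Sum>S1\<in>?Q. \<Sum>S2\<in>?Q. X S1 S2) + ?D * (\<Sum>S2\<in>?Q. \<Sum>S3\<in>?Q. Y S2 S3)
      + ?D * (\<Sum>S1\<in>?Q. \<Sum>S3\<in>?Q. Z S1 S3)"
    using cQ by (simp add: sum.distrib sum_distrib_left)
  also have "\<dots> = ?D * (card (lost_pairs T t F f g) + card (lost_pairs T t F g h)
      + card (lost_pairs T t F f h))"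
    unfolding X_def Y_def Z_def a_def b_def c_def card_lost_pairs[OF T, symmetric]
    by (simp add: algebra_simps)
  also have "(\<Sum>S1\<in>?Q. \<Sum>S2\<in>?Q. \<Sum>S3\<in>?Q. 1/2 - ((a S1)\<^sup>2 + (b S2)\<^sup>2 + (c S3)\<^sup>2) / 2)
      = ?D * (?D * ?D / 2 - ?D / 2 * ((\<Sum>S\<in>?Q. (a S)\<^sup>2) + (\<Sum>S\<in>?Q. (b S)\<^sup>2) + (\<Sum>S\<in>?Q. (c S)\<^sup>2)))"
    using cQ by (simp add: sum.distrib sum_subtractf sum_distrib_left[symmetric]
        sum_distrib_right[symmetric] sum_divide_distrib[symmetric] algebra_simps add_divide_distrib)
  also have "\<dots> = ?D * (4 ^ card T / 2 - ?D / 2 * (bias_energy T f t + bias_energy T g t + bias_energy T h t))"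
  proof -
    have "?D * ?D = 4 ^ card T" by (simp flip: power_mult_distrib)
    then show ?thesis by (simp only: bias_energy_def a_def b_def c_def)
  qed
  finally have "?D * (4 ^ card T / 2 - ?D / 2 * (bias_energy T f t + bias_energy T g t + bias_energy T h t))
    \<le> ?D * (card (lost_pairs T t F f g) + card (lost_pairs T t F g h)
      + card (lost_pairs T t F f h))" .
  then show ?thesis
    by (rule mult_left_le_imp_le) (rule zero_less_power, rule zero_less_numeral)
qed

section \<open>Bit blow-ups of Ruzsa-Szemeredi systems\<close>

text \<open>The definition of \<open>TFL_bound\<close> speaks of graphs on natural numbers. Numbering the vertices
  transfers it to finite graphs on any type.\<close>

lemma TFL_boundD:
  fixes V :: "'a set"
  assumes bound: "TFL_bound \<epsilon> M" and V: "simple_graph V E" and tf: "triangle_free E"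
  obtains W :: "nat set" and F \<phi> where "simple_graph W F" "triangle_free F" "card W \<le> M"
    "approx_hom \<epsilon> V E W F \<phi>"
proof -
  have fV: "finite V" and EV: "\<And>e. e \<in> E \<Longrightarrow> e \<subseteq> V" and E2: "\<And>e. e \<in> E \<Longrightarrow> card e = 2"
    using V by (auto simp: simple_graph_def)
  obtain g :: "'a \<Rightarrow> nat" where g: "inj_on g V"
    using finite_imp_inj_to_nat_seg[OF fV] by blast
  define h where "h = inv_into V g"
  have hg: "h ` g ` e = e" if "e \<in> E" for e
    using EV[OF that] g by (simp add: h_def)
  define E' where "E' = (`) g ` E"
  have "simple_graph (g ` V) E'"
    using fV EV E2 card_image[OF inj_on_subset[OF g]] by (auto simp: simple_graph_def E'_def)
  moreover have "triangle_free E'"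
  proof -
    have "{h x, h y} \<in> E" if xy: "{x, y} \<in> E'" for x y
    proof -
      obtain e where e: "e \<in> E" "{x, y} = g ` e" using xy by (auto simp: E'_def)
      have "{h x, h y} = h ` {x, y}" by simp
      also have "\<dots> = e" using e hg by simp
      finally show ?thesis using e by simp
    qed
    then show ?thesis using tf unfolding triangle_free_def by blast
  qed
  ultimately obtain W :: "nat set" and F \<phi> where W: "simple_graph W F" "triangle_free F" "card W \<le> M"
    and hom: "approx_hom \<epsilon> (g ` V) E' W F \<phi>"
    using bound unfolding TFL_bound_def by blast
  have "approx_hom \<epsilon> V E W F (\<phi> \<circ> g)"
  proof -
    have "{e \<in> E'. \<phi> ` e \<notin> F} = (`) g ` {e \<in> E. (\<phi> \<circ> g) ` e \<notin> F}"
      by (auto simp: E'_def image_comp)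
    moreover have "inj_on ((`) g) {e \<in> E. (\<phi> \<circ> g) ` e \<notin> F}"
      by (rule inj_on_subset[OF inj_on_image_Pow[OF g]]) (use EV in auto)
    ultimately have "card {e \<in> E'. \<phi> ` e \<notin> F} = card {e \<in> E. (\<phi> \<circ> g) ` e \<notin> F}"
      by (simp add: card_image)
    then show ?thesis
      using hom card_image[OF g] by (auto simp: approx_hom_def)
  qed
  then show ?thesis using that W by blast
qed

text \<open>The three pairs of a triangle in the shadow of \<open>T\<close> may only come from one and the same triple. The
  condition includes linearity, by \<open>rs_system_linear\<close>.\<close>

definition rs_system :: "'a set set \<Rightarrow> bool" where
  "rs_system T \<longleftrightarrow> (\<forall>t\<in>T. card t = 3) \<and>
     (\<forall>p q r. \<forall>t1\<in>T. \<forall>t2\<in>T. \<forall>t3\<in>T. p \<noteq> q \<and> q \<noteq> r \<and> p \<noteq> r \<and>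
        {p, q} \<subseteq> t1 \<and> {q, r} \<subseteq> t2 \<and> {p, r} \<subseteq> t3 \<longrightarrow> t1 = t2 \<and> t1 = t3)"

text \<open>If \<open>t1\<close> and \<open>t2\<close> share the pair \<open>p\<close>, \<open>q\<close>, then this pair in \<open>t1\<close> and the other two
  pairs in \<open>t2\<close> form a triangle in the shadow.\<close>

lemma rs_system_linear:
  assumes rs: "rs_system T" and t: "t1 \<in> T" "t2 \<in> T" and pq: "p \<noteq> q" "{p, q} \<subseteq> t1" "{p, q} \<subseteq> t2"
  shows "t1 = t2"
proof -
  have "card t2 = 3" using rs t by (auto simp: rs_system_def)
  then have "\<not> t2 \<subseteq> {p, q}"
    using card_mono[of "{p, q}" t2] pq(1) by auto
  then obtain r where "r \<in> t2" "r \<noteq> p" "r \<noteq> q" by auto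
  then show ?thesis
    using rs[unfolded rs_system_def, THEN conjunct2, rule_format, of t1 t2 t2 p q r] t pq by auto
qed

text \<open>The copy \<open>(p, S)\<close> of the vertex \<open>p\<close> carries the bits given by the indicator function of \<open>S\<close>. Adjacent
  copies differ in the bit of their triple, a rule that treats the three pairs of a triple alike.\<close>

definition bit_blowup :: "'a set set \<Rightarrow> ('a \<times> 'a set set) set set" where
  "bit_blowup T = {{(p, S), (q, S')} | p q S S' t. t \<in> T \<and> p \<in> t \<and> q \<in> t \<and> p \<noteq> q \<and>
     S \<in> Pow T \<and> S' \<in> Pow T \<and> (t \<in> S) \<noteq> (t \<in> S')}"

lemma bit_blowupI:
  assumes "t \<in> T" "p \<in> t" "q \<in> t" "p \<noteq> q" "S \<in> Pow T" "S' \<in> Pow T" "(t \<in> S) \<noteq> (t \<in> S')"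
  shows "{(p, S), (q, S')} \<in> bit_blowup T"
  unfolding bit_blowup_def mem_Collect_eq
  by (intro exI conjI) (rule refl assms)+

lemma bit_blowupE:
  assumes "e \<in> bit_blowup T"
  obtains p q S S' t where "e = {(p, S), (q, S')}" "t \<in> T" "p \<in> t" "q \<in> t" "p \<noteq> q"
    "S \<in> Pow T" "S' \<in> Pow T" "(t \<in> S) \<noteq> (t \<in> S')"
  using assms unfolding bit_blowup_def mem_Collect_eq by (elim exE conjE) (rule that)

lemma bit_blowup_edgeD:
  assumes "{(p, S), (q, S')} \<in> bit_blowup T"
  shows "\<exists>t\<in>T. p \<in> t \<and> q \<in> t \<and> p \<noteq> q \<and> (t \<in> S) \<noteq> (t \<in> S')"
proof -
  obtain p' S1 q' S2 t where e: "{(p, S), (q, S')} = {(p', S1), (q', S2)}"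
    and t: "t \<in> T" "p' \<in> t" "q' \<in> t" "p' \<noteq> q'" "(t \<in> S1) \<noteq> (t \<in> S2)"
    by (rule bit_blowupE[OF assms])
  from e have "p = p' \<and> S = S1 \<and> q = q' \<and> S' = S2 \<or> p = q' \<and> S = S2 \<and> q = p' \<and> S' = S1"
    unfolding doubleton_eq_iff by blast
  then show ?thesis
  proof
    assume "p = p' \<and> S = S1 \<and> q = q' \<and> S' = S2"
    then show ?thesis using t by blast
  next
    assume "p = q' \<and> S = S2 \<and> q = p' \<and> S' = S1"
    then show ?thesis using t by blast
  qed
qed

lemma simple_graph_bit_blowup:
  assumes "finite P" "T \<subseteq> Pow P"
  shows "simple_graph (P \<times> Pow T) (bit_blowup T)"
  unfolding simple_graph_def
proof (intro conjI ballI)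
  have "finite T" using assms finite_subset by auto
  then show "finite (P \<times> Pow T)" using assms by simp
next
  fix e assume "e \<in> bit_blowup T"
  then obtain p q S S' t where e: "e = {(p, S), (q, S')}" "t \<in> T" "p \<in> t" "q \<in> t" "p \<noteq> q"
    "S \<in> Pow T" "S' \<in> Pow T"
    by (rule bit_blowupE)
  then show "e \<subseteq> P \<times> Pow T" using assms(2) by blast
  show "card e = 2" using e by simp
qed

text \<open>The three edges of a triangle would belong to one triple \<open>t\<close>, and three values of bit \<open>t\<close> cannot be
  pairwise distinct.\<close>

lemma triangle_free_bit_blowup:
  assumes rs: "rs_system T"
  shows "triangle_free (bit_blowup T)"
  unfolding triangle_free_def
proof (intro notI, elim exE conjE)
  fix x y z assume e: "{x, y} \<in> bit_blowup T" "{y, z} \<in> bit_blowup T" "{x, z} \<in> bit_blowup T"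
  obtain p S where x: "x = (p, S)" by (cases x)
  obtain q S' where y: "y = (q, S')" by (cases y)
  obtain r S'' where z: "z = (r, S'')" by (cases z)
  obtain t1 where t1: "t1 \<in> T" "p \<in> t1" "q \<in> t1" "p \<noteq> q" "(t1 \<in> S) \<noteq> (t1 \<in> S')"
    using bit_blowup_edgeD[OF e(1)[unfolded x y]] by blast
  obtain t2 where t2: "t2 \<in> T" "q \<in> t2" "r \<in> t2" "q \<noteq> r" "(t2 \<in> S') \<noteq> (t2 \<in> S'')"
    using bit_blowup_edgeD[OF e(2)[unfolded y z]] by blast
  obtain t3 where t3: "t3 \<in> T" "p \<in> t3" "r \<in> t3" "p \<noteq> r" "(t3 \<in> S) \<noteq> (t3 \<in> S'')"
    using bit_blowup_edgeD[OF e(3)[unfolded x z]] by blast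
  have "t1 = t2 \<and> t1 = t3"
    using t1 t2 t3
    by (intro rs[unfolded rs_system_def, THEN conjunct2, rule_format, of t1 t2 t3 p q r]) simp_all
  then have "t2 = t1" "t3 = t1" by blast+
  with t1(5) t2(5) t3(5) show False by blast
qed

lemma lost_edges_of_triangle_ge:
  assumes T: "finite T" and F: "triangle_free F" and t: "t \<in> T" "card t = 3"
    and fin: "finite (bit_blowup T)"
  shows "4 ^ card T / 2 - 2 ^ card T / 2 * (\<Sum>p\<in>t. bias_energy T (\<lambda>S. \<phi> (p, S)) t)
    \<le> card {e \<in> bit_blowup T. \<phi> ` e \<notin> F \<and> fst ` e \<subseteq> t}"
proof -
  obtain p q r where pqr: "t = {p, q, r}" "p \<noteq> q" "q \<noteq> r" "p \<noteq> r"
    using t(2) unfolding card_3_iff by (elim exE conjE) (rule that)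
  define f where "f v = (\<lambda>S. \<phi> (v, S))" for v
  define L where "L u v = (\<lambda>(S, S'). {(u, S), (v, S')}) ` lost_pairs T t F (f u) (f v)" for u v
  have cardL: "card (L u v) = card (lost_pairs T t F (f u) (f v))" if "u \<noteq> v" for u v
    unfolding L_def
  proof (intro card_image inj_onI)
    fix x y :: "'a set set \<times> 'a set set"
    assume "(case x of (S, S') \<Rightarrow> {(u, S), (v, S')}) = (case y of (S, S') \<Rightarrow> {(u, S), (v, S')})"
    then have "{(u, fst x), (v, snd x)} = {(u, fst y), (v, snd y)}" by (simp add: split_def)
    then have "fst x = fst y \<and> snd x = snd y"
      using that unfolding doubleton_eq_iff by simp
    then show "x = y" by (simp add: prod_eq_iff)
  qed
  have sub: "L u v \<subseteq> {e \<in> bit_blowup T. \<phi> ` e \<notin> F \<and> fst ` e \<subseteq> t}"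
    if "u \<noteq> v" "u \<in> t" "v \<in> t" for u v
  proof
    fix e assume "e \<in> L u v"
    then obtain S S' where S: "e = {(u, S), (v, S')}" "S \<in> Pow T" "S' \<in> Pow T"
      "(t \<in> S) \<noteq> (t \<in> S')" "{f u S, f v S'} \<notin> F"
      by (auto simp: L_def lost_pairs_def)
    have "e \<in> bit_blowup T"
      unfolding S(1) by (intro bit_blowupI[of t] t(1) that S)
    then show "e \<in> {e \<in> bit_blowup T. \<phi> ` e \<notin> F \<and> fst ` e \<subseteq> t}"
      using S(1,5) that by (simp add: f_def)
  qed
  have fst_L: "fst ` e = {u, v}" if "e \<in> L u v" for e u v
    using that by (auto simp: L_def)
  \<comment> \<open>The three families are told apart by the pair of vertices below an edge.\<close>
  have disj: "L p q \<inter> L q r = {}" "(L p q \<union> L q r) \<inter> L p r = {}"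
  proof -
    have "L u v \<inter> L u' v' = {}" if "{u, v} \<noteq> {u', v'}" for u v u' v'
    proof (intro equals0I)
      fix e assume "e \<in> L u v \<inter> L u' v'"
      then have "{u, v} = {u', v'}" using fst_L[of e u v] fst_L[of e u' v'] by simp
      then show False using that by contradiction
    qed
    moreover have "{p, q} \<noteq> {q, r}" "{p, q} \<noteq> {p, r}" "{q, r} \<noteq> {p, r}"
      using pqr by (simp_all add: doubleton_eq_iff)
    ultimately show "L p q \<inter> L q r = {}" "(L p q \<union> L q r) \<inter> L p r = {}"
      by (simp_all add: Int_Un_distrib2)
  qed
  have finL: "finite (L u v)" for u v
    unfolding L_def lost_pairs_def
    by (intro finite_imageI, rule finite_subset[of _ "Pow T \<times> Pow T"]) (use T in auto)
  have "card (L p q) + card (L q r) + card (L p r) = card (L p q \<union> L q r \<union> L p r)"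
    using disj finL by (simp add: card_Un_disjoint)
  also have "\<dots> \<le> card {e \<in> bit_blowup T. \<phi> ` e \<notin> F \<and> fst ` e \<subseteq> t}"
  proof (rule card_mono)
    have "p \<in> t" "q \<in> t" "r \<in> t" by (simp_all add: pqr(1))
    then show "L p q \<union> L q r \<union> L p r \<subseteq> {e \<in> bit_blowup T. \<phi> ` e \<notin> F \<and> fst ` e \<subseteq> t}"
      by (intro Un_least sub pqr(2-4))
  qed (use fin in simp)
  finally have count: "card (lost_pairs T t F (f p) (f q)) + card (lost_pairs T t F (f q) (f r))
      + card (lost_pairs T t F (f p) (f r)) \<le> card {e \<in> bit_blowup T. \<phi> ` e \<notin> F \<and> fst ` e \<subseteq> t}"
    by (simp only: cardL[OF pqr(2)] cardL[OF pqr(3)] cardL[OF pqr(4)])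
  have energy: "(\<Sum>p\<in>t. bias_energy T (\<lambda>S. \<phi> (p, S)) t) =
      bias_energy T (f p) t + bias_energy T (f q) t + bias_energy T (f r) t"
    using pqr(2-4) unfolding pqr(1) by (simp add: f_def)
  show ?thesis
    unfolding energy
    using lost_pairs_of_triangle_ge[OF T F, where t = t and f = "f p" and g = "f q" and h = "f r"]
      of_nat_mono[OF count, where 'a = real] by (rule order_trans)
qed

text \<open>By linearity each edge belongs to one triple, so the losses in the triples add up. The total
  reduction by biases is at most a multiple of \<open>card P * ln M\<close>: each vertex of \<open>P\<close> contributes the
  energy of one colouring of the cube with at most \<open>M\<close> colours, summed over all bits.\<close>

theorem rs_system_lower_bound:
  fixes \<epsilon> :: real
  assumes P: "finite P" "P \<noteq> {}" and TP: "T \<subseteq> Pow P" and rs: "rs_system T"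
    and bound: "TFL_bound \<epsilon> M"
  shows "real (card T) \<le> 4 * real (card P) * ln M + 2 * \<epsilon> * (real (card P))\<^sup>2"
proof -
  let ?N = "real (card P)" and ?D = "2 ^ card T :: real"
  have T: "finite T" using P TP finite_subset by auto
  define V where "V = P \<times> Pow T"
  have sg: "simple_graph V (bit_blowup T)"
    unfolding V_def by (rule simple_graph_bit_blowup[OF P(1) TP])
  obtain W :: "nat set" and F \<phi> where W: "simple_graph W F" "triangle_free F" "card W \<le> M"
    and hom: "approx_hom \<epsilon> V (bit_blowup T) W F \<phi>"
    using TFL_boundD[OF bound sg triangle_free_bit_blowup[OF rs]] by blast
  have fin: "finite (bit_blowup T)"
  proof (rule finite_subset)
    show "bit_blowup T \<subseteq> Pow V" using sg by (auto simp: simple_graph_def)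
    show "finite (Pow V)" using sg by (auto simp: simple_graph_def)
  qed
  define lost where "lost t = {e \<in> bit_blowup T. \<phi> ` e \<notin> F \<and> fst ` e \<subseteq> t}" for t
  have disj: "lost t \<inter> lost t' = {}" if tt: "t \<in> T" "t' \<in> T" "t \<noteq> t'" for t t'
  proof (rule ccontr)
    assume "lost t \<inter> lost t' \<noteq> {}"
    then obtain e where e: "e \<in> bit_blowup T" "fst ` e \<subseteq> t" "fst ` e \<subseteq> t'"
      by (auto simp: lost_def)
    then obtain p q S S' where "e = {(p, S), (q, S')}" "p \<noteq> q"
      by (elim bit_blowupE)
    then show False using rs_system_linear[OF rs tt(1,2), of p q] e tt(3) by auto
  qed
  have energy: "(\<Sum>t\<in>T. bias_energy T (\<lambda>S. \<phi> (p, S)) t) \<le> 4 * ?D * ln M" if "p \<in> P" for p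
  proof (rule sum_bias_energy_le[OF T])
    have "(\<lambda>S. \<phi> (p, S)) ` Pow T \<subseteq> W"
      using hom that by (auto simp: approx_hom_def V_def)
    then have "card ((\<lambda>S. \<phi> (p, S)) ` Pow T) \<le> card W"
      using W by (intro card_mono) (auto simp: simple_graph_def)
    then show "card ((\<lambda>S. \<phi> (p, S)) ` Pow T) \<le> M" using W by simp
  qed
  have "(\<Sum>t\<in>T. \<Sum>p\<in>t. bias_energy T (\<lambda>S. \<phi> (p, S)) t)
      \<le> (\<Sum>t\<in>T. \<Sum>p\<in>P. bias_energy T (\<lambda>S. \<phi> (p, S)) t)"
    using P TP by (intro sum_mono sum_mono2) (auto simp: bias_energy_def intro: sum_nonneg)
  also have "\<dots> = (\<Sum>p\<in>P. \<Sum>t\<in>T. bias_energy T (\<lambda>S. \<phi> (p, S)) t)"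
    by (rule sum.swap)
  also have "\<dots> \<le> (\<Sum>p\<in>P. 4 * ?D * ln M)"
    by (intro sum_mono energy)
  finally have total: "(\<Sum>t\<in>T. \<Sum>p\<in>t. bias_energy T (\<lambda>S. \<phi> (p, S)) t) \<le> ?N * (4 * ?D * ln M)"
    by simp
  have "?D\<^sup>2 * (card T / 2 - 2 * ?N * ln M) = card T * (4 ^ card T / 2) - ?D / 2 * (?N * (4 * ?D * ln M))"
  proof -
    have "4 ^ card T = ?D * ?D" by (simp flip: power_mult_distrib)
    moreover have "d\<^sup>2 * (t / 2 - 2 * n * l) = t * (d * d / 2) - d / 2 * (n * (4 * d * l))"
      for d t n l :: real
      by (simp add: field_simps power2_eq_square)
    ultimately show ?thesis by (simp only:)
  qed
  also have "\<dots> \<le> card T * (4 ^ card T / 2) - ?D / 2 * (\<Sum>t\<in>T. \<Sum>p\<in>t. bias_energy T (\<lambda>S. \<phi> (p, S)) t)"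
    using total by (intro diff_left_mono mult_left_mono) auto
  also have "\<dots> = (\<Sum>t\<in>T. 4 ^ card T / 2 - ?D / 2 * (\<Sum>p\<in>t. bias_energy T (\<lambda>S. \<phi> (p, S)) t))"
    by (simp only: sum_subtractf sum_distrib_left sum_constant)
  also have "\<dots> \<le> (\<Sum>t\<in>T. real (card (lost t)))"
    unfolding lost_def using rs
    by (intro sum_mono lost_edges_of_triangle_ge[OF T W(2) _ _ fin]) (auto simp: rs_system_def)
  also have "\<dots> = real (card (\<Union>t\<in>T. lost t))"
    using T fin disj by (subst card_UN_disjoint) (auto simp: lost_def)
  also have "\<dots> \<le> real (card {e \<in> bit_blowup T. \<phi> ` e \<notin> F})"
    using fin by (intro of_nat_mono card_mono) (auto simp: lost_def)
  also have "\<dots> \<le> \<epsilon> * (real (card V))\<^sup>2"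
    using hom by (simp add: approx_hom_def)
  also have "\<dots> = ?D\<^sup>2 * (\<epsilon> * ?N\<^sup>2)"
    using T by (simp add: V_def card_cartesian_product card_Pow power_mult_distrib)
  finally have "?D\<^sup>2 * (card T / 2 - 2 * ?N * ln M) \<le> ?D\<^sup>2 * (\<epsilon> * ?N\<^sup>2)" .
  then have "card T / 2 - 2 * ?N * ln M \<le> \<epsilon> * ?N\<^sup>2"
    by (rule mult_left_le_imp_le) (intro zero_less_power, rule zero_less_numeral)
  then show ?thesis by linarith
qed

section \<open>Behrend's sets without 3-term progressions\<close>

definition ap3_free :: "nat set \<Rightarrow> bool" where
  "ap3_free A \<longleftrightarrow> (\<forall>a\<in>A. \<forall>b\<in>A. \<forall>c\<in>A. a + c = 2 * b \<longrightarrow> a = b \<and> c = b)"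

lemma digits_unique:
  fixes x y :: "nat \<Rightarrow> nat"
  assumes "\<And>i. i < k \<Longrightarrow> x i < B" "\<And>i. i < k \<Longrightarrow> y i < B"
    and "(\<Sum>i<k. x i * B ^ i) = (\<Sum>i<k. y i * B ^ i)" and "i < k"
  shows "x i = y i"
  using assms
proof (induction k arbitrary: x y i)
  case (Suc k)
  have split: "(\<Sum>i<Suc k. z i * B ^ i) = z 0 + B * (\<Sum>i<k. z (Suc i) * B ^ i)" for z :: "nat \<Rightarrow> nat"
    by (simp add: sum.lessThan_Suc_shift sum_distrib_left mult_ac del: sum.lessThan_Suc)
  have eq: "x 0 + B * (\<Sum>i<k. x (Suc i) * B ^ i) = y 0 + B * (\<Sum>i<k. y (Suc i) * B ^ i)"
    using Suc.prems(3) unfolding split .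
  have lt: "x 0 < B" "y 0 < B" using Suc.prems by auto
  have x0: "x 0 = y 0"
    using arg_cong[OF eq, of "\<lambda>n. n mod B"] lt by simp
  have "(\<Sum>i<k. x (Suc i) * B ^ i) = (\<Sum>i<k. y (Suc i) * B ^ i)"
    using eq x0 lt by simp
  then have "x (Suc j) = y (Suc j)" if "j < k" for j
    using Suc.IH[of "\<lambda>i. x (Suc i)" "\<lambda>i. y (Suc i)" j] Suc.prems that by simp
  then show ?case using x0 Suc.prems(4) by (cases i) auto
qed simp

lemma digit_sum_less:
  fixes x :: "nat \<Rightarrow> nat"
  assumes "\<And>i. i < k \<Longrightarrow> x i < B"
  shows "(\<Sum>i<k. x i * B ^ i) < B ^ k"
  using assms
proof (induction k)
  case (Suc k)
  have "(\<Sum>i<Suc k. x i * B ^ i) < B ^ k + x k * B ^ k"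
    using Suc by simp
  also have "\<dots> = (x k + 1) * B ^ k" by simp
  also have "\<dots> \<le> B * B ^ k"
    using Suc.prems[of k] by (intro mult_right_mono) auto
  finally show ?case by simp
qed simp

text \<open>A sphere is strictly convex, so it contains the midpoint of two of its points only if they coincide.
  Algebraically, the parallelogram law expresses the squared distance of \<open>x\<close> and \<open>z\<close> by
  the three norms.\<close>

lemma midpoint_on_sphere:
  fixes x y z :: "nat \<Rightarrow> nat"
  assumes mid: "\<And>i. i < k \<Longrightarrow> x i + z i = 2 * y i"
    and "(\<Sum>i<k. (x i)\<^sup>2) = r" "(\<Sum>i<k. (y i)\<^sup>2) = r" "(\<Sum>i<k. (z i)\<^sup>2) = r"
    and "i < k"
  shows "x i = y i \<and> z i = y i"
proof -
  have "(\<Sum>i<k. (int (x i) - int (z i))\<^sup>2) =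
      (\<Sum>i<k. 2 * int ((x i)\<^sup>2) + 2 * int ((z i)\<^sup>2) - 4 * int ((y i)\<^sup>2))"
  proof (intro sum.cong refl)
    fix i assume "i \<in> {..<k}"
    then have m: "int (x i) + int (z i) = 2 * int (y i)"
      using mid[of i] by (metis lessThan_iff of_nat_add of_nat_mult of_nat_numeral)
    have "(int (x i) - int (z i))\<^sup>2 = 2 * (int (x i))\<^sup>2 + 2 * (int (z i))\<^sup>2 - (int (x i) + int (z i))\<^sup>2"
      by (simp add: power2_eq_square algebra_simps)
    then show "(int (x i) - int (z i))\<^sup>2 = 2 * int ((x i)\<^sup>2) + 2 * int ((z i)\<^sup>2) - 4 * int ((y i)\<^sup>2)"
      unfolding m by (simp add: power_mult_distrib)
  qed
  also have "\<dots> = 2 * int (\<Sum>i<k. (x i)\<^sup>2) + 2 * int (\<Sum>i<k. (z i)\<^sup>2) - 4 * int (\<Sum>i<k. (y i)\<^sup>2)"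
    by (simp add: sum.distrib sum_subtractf sum_distrib_left)
  also have "\<dots> = 0" using assms by simp
  finally have "(int (x i) - int (z i))\<^sup>2 = 0"
    using \<open>i < k\<close> by (subst (asm) sum_nonneg_eq_0_iff) auto
  then show ?thesis using mid[OF \<open>i < k\<close>] by simp
qed

text \<open>Behrend's construction: among the vectors with \<open>k\<close> digits below \<open>2 ^ k\<close>, take a most popular sphere
  and read its points as numbers to base \<open>2 ^ (k + 1)\<close>. The base is twice the bound on the digits, so
  adding two such numbers causes no carry, and a 3-term progression of numbers comes from a point of
  the sphere that is the midpoint of two others.\<close>

lemma behrend:
  fixes k :: nat
  assumes "k \<ge> 1"
  shows "\<exists>A. A \<subseteq> {..<2 ^ (k * (k + 1))} \<and> ap3_free A \<and> 2 ^ (k * k) \<le> card A * 8 ^ k"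
proof -
  define q B where "q = (2::nat) ^ k" and "B = (2::nat) ^ (k + 1)"
  define X where "X = ({..<k} \<rightarrow>\<^sub>E {..<q} :: (nat \<Rightarrow> nat) set)"
  define nrm where "nrm x = (\<Sum>i<k. (x i)\<^sup>2)" for x :: "nat \<Rightarrow> nat"
  define code where "code x = (\<Sum>i<k. x i * B ^ i)" for x :: "nat \<Rightarrow> nat"
  have q: "q > 0" by (simp add: q_def)
  have fX: "finite X" unfolding X_def by (intro finite_PiE) auto
  have digit: "x i < q" if "x \<in> X" "i < k" for x i
    using that by (auto simp: X_def)
  have "q < B" by (simp add: q_def B_def)
  then have digit': "x i < B" if "x \<in> X" "i < k" for x i
    using digit[OF that] by simp
  \<comment> \<open>The number of spheres, at most \<open>8 ^ k\<close>, is the loss in the pigeonhole argument.\<close>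
  have "nrm \<in> X \<rightarrow> {..<k * q\<^sup>2}"
  proof
    fix x assume x: "x \<in> X"
    have "nrm x < (\<Sum>i<k. q\<^sup>2)" unfolding nrm_def
      using assms digit[OF x] by (intro sum_strict_mono power_strict_mono) (auto simp: lessThan_empty_iff)
    then show "nrm x \<in> {..<k * q\<^sup>2}" by simp
  qed
  then obtain r where r: "card X \<le> card (nrm -` {r} \<inter> X) * card {..<k * q\<^sup>2}"
    using pigeonhole_card[of nrm X "{..<k * q\<^sup>2}"] fX assms q by (auto simp: lessThan_empty_iff)
  define Y where "Y = nrm -` {r} \<inter> X"
  have inj: "inj_on code Y"
  proof
    fix x y assume xy: "x \<in> Y" "y \<in> Y" "code x = code y"
    then have X: "x \<in> X" "y \<in> X" by (auto simp: Y_def)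
    have "x i = y i" if "i < k" for i
      using digit'[OF X(1)] digit'[OF X(2)] xy(3) that
      by (intro digits_unique[of k x B y i]) (auto simp: code_def)
    then show "x = y" using X unfolding X_def by (intro PiE_ext) auto
  qed
  have "2 ^ (k * k) = card X" by (simp add: X_def card_PiE q_def power_mult)
  also have "\<dots> \<le> card Y * (k * q\<^sup>2)" using r by (simp add: Y_def)
  also have "\<dots> \<le> card Y * (2 ^ k * q\<^sup>2)"
    by (intro mult_left_mono mult_right_mono) (auto simp: less_imp_le)
  also have "2 ^ k * q\<^sup>2 = 8 ^ k"
    by (simp add: q_def power2_eq_square power_mult_distrib[symmetric])
  finally have size: "2 ^ (k * k) \<le> card (code ` Y) * 8 ^ k" by (simp add: card_image[OF inj])
  have "code ` Y \<subseteq> {..<2 ^ (k * (k + 1))}"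
  proof
    fix n assume "n \<in> code ` Y"
    then obtain x where x: "x \<in> X" "n = code x" by (auto simp: Y_def)
    have "code x < B ^ k" unfolding code_def
      using digit'[OF x(1)] by (intro digit_sum_less)
    also have "B ^ k = 2 ^ (k * (k + 1))"
      by (simp only: B_def power_mult[symmetric] mult.commute)
    finally show "n \<in> {..<2 ^ (k * (k + 1))}" using x by simp
  qed
  moreover have "ap3_free (code ` Y)"
    unfolding ap3_free_def
  proof (intro ballI impI)
    fix a b c assume "a \<in> code ` Y" "b \<in> code ` Y" "c \<in> code ` Y" and ap: "a + c = 2 * b"
    then obtain x y z where xyz: "x \<in> Y" "a = code x" "y \<in> Y" "b = code y" "z \<in> Y" "c = code z"
      by auto
    then have X: "x \<in> X" "y \<in> X" "z \<in> X" by (auto simp: Y_def)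
    have "(\<Sum>i<k. (x i + z i) * B ^ i) = (\<Sum>i<k. (2 * y i) * B ^ i)"
      using ap xyz by (simp add: code_def sum.distrib sum_distrib_left algebra_simps)
    moreover have "x i + z i < B" "2 * y i < B" if "i < k" for i
      using digit[OF X(1) that] digit[OF X(2) that] digit[OF X(3) that] by (auto simp: B_def q_def)
    ultimately have mid: "x i + z i = 2 * y i" if "i < k" for i
      using digits_unique[of k "\<lambda>i. x i + z i" B "\<lambda>i. 2 * y i" i] that by simp
    have nr: "nrm x = r" "nrm y = r" "nrm z = r" using xyz by (auto simp: Y_def)
    have "x i = y i \<and> z i = y i" if "i < k" for i
      using mid that nr unfolding nrm_def by (intro midpoint_on_sphere[of k x z y r i]) auto
    then have "x = y" "z = y" using X PiE_ext[of _ "{..<k}" "\<lambda>_. {..<q}"] by (auto simp: X_def)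
    then show "a = b \<and> c = b" using xyz by simp
  qed
  ultimately show ?thesis using size by blast
qed

section \<open>The system of 3-term progressions\<close>

text \<open>The first component is the part of a tripartite vertex set.\<close>

definition ap_triangle :: "nat \<Rightarrow> nat \<Rightarrow> (nat \<times> nat) set" where
  "ap_triangle x a = {(0, x), (1, x + a), (2, x + 2 * a)}"

lemma ap_triangle_eq_iff [simp]: "ap_triangle x a = ap_triangle y b \<longleftrightarrow> x = y \<and> a = b"
proof
  assume eq: "ap_triangle x a = ap_triangle y b"
  have "(0, x) \<in> ap_triangle y b" "(1, x + a) \<in> ap_triangle y b"
    unfolding eq[symmetric] by (simp_all add: ap_triangle_def)
  then show "x = y \<and> a = b" by (simp add: ap_triangle_def)
qed simp

definition ap_triangles :: "nat \<Rightarrow> nat set \<Rightarrow> (nat \<times> nat) set set" where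
  "ap_triangles n A = (\<lambda>(x, a). ap_triangle x a) ` ({..<n} \<times> A)"

text \<open>The differences of a triangle in the shadow are \<open>a1\<close>, \<open>a2\<close> and their mean \<open>a3\<close>, a 3-term
  progression in \<open>A\<close>; so all three are equal.\<close>

lemma ap_triangles_ordered:
  assumes A: "ap3_free A"
    and t: "t1 \<in> ap_triangles n A" "t2 \<in> ap_triangles n A" "t3 \<in> ap_triangles n A"
    and mem: "(0, u) \<in> t1" "(1, v) \<in> t1" "(1, v) \<in> t2" "(2, w) \<in> t2" "(0, u) \<in> t3" "(2, w) \<in> t3"
  shows "t1 = t2 \<and> t1 = t3"
proof -
  obtain x1 a1 x2 a2 x3 a3 where xa: "t1 = ap_triangle x1 a1" "a1 \<in> A" "t2 = ap_triangle x2 a2" "a2 \<in> A"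
    "t3 = ap_triangle x3 a3" "a3 \<in> A"
    using t unfolding ap_triangles_def by auto
  have eqs: "u = x1" "v = x1 + a1" "v = x2 + a2" "w = x2 + 2 * a2" "u = x3" "w = x3 + 2 * a3"
    using mem by (auto simp: xa ap_triangle_def)
  then have "a1 + a2 = 2 * a3" by linarith
  then have "a1 = a3 \<and> a2 = a3" using A xa unfolding ap3_free_def by blast
  then show ?thesis using eqs xa by simp
qed

text \<open>The vertices of a triangle lie in different parts. Each of the six ways to order them reduces
  to \<open>ap_triangles_ordered\<close>.\<close>

lemma rs_system_ap_triangles:
  assumes A: "ap3_free A"
  shows "rs_system (ap_triangles n A)"
  unfolding rs_system_def
proof (intro conjI ballI allI impI)
  fix t assume "t \<in> ap_triangles n A"
  then show "card t = 3" by (auto simp: ap_triangles_def ap_triangle_def)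
next
  fix p q r t1 t2 t3
  assume t: "t1 \<in> ap_triangles n A" "t2 \<in> ap_triangles n A" "t3 \<in> ap_triangles n A"
    and asm: "p \<noteq> q \<and> q \<noteq> r \<and> p \<noteq> r \<and> {p, q} \<subseteq> t1 \<and> {q, r} \<subseteq> t2 \<and> {p, r} \<subseteq> t3"
  have level: "fst x \<in> {0, 1, 2}" "fst x = fst y \<Longrightarrow> x = y"
    if "t \<in> ap_triangles n A" "x \<in> t" "y \<in> t" for x y t
    using that by (auto simp: ap_triangles_def ap_triangle_def)
  obtain i u where p: "p = (i, u)" by (cases p)
  obtain j v where q: "q = (j, v)" by (cases q)
  obtain l w where r: "r = (l, w)" by (cases r)
  have ij: "i \<noteq> j" using level(2)[OF t(1), of p q] asm p q by auto
  have jl: "j \<noteq> l" using level(2)[OF t(2), of q r] asm q r by auto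
  have il: "i \<noteq> l" using level(2)[OF t(3), of p r] asm p r by auto
  have lv: "i \<in> {0, 1, 2}" "j \<in> {0, 1, 2}" "l \<in> {0, 1, 2}"
    using level(1)[OF t(1), of p p] level(1)[OF t(1), of q q] level(1)[OF t(2), of r r] asm p q r by auto
  have mem: "(i, u) \<in> t1" "(j, v) \<in> t1" "(j, v) \<in> t2" "(l, w) \<in> t2" "(i, u) \<in> t3" "(l, w) \<in> t3"
    using asm p q r by auto
  consider "i = 0" "j = 1" "l = 2" | "i = 0" "j = 2" "l = 1" | "i = 1" "j = 0" "l = 2"
    | "i = 1" "j = 2" "l = 0" | "i = 2" "j = 0" "l = 1" | "i = 2" "j = 1" "l = 0"
    using lv ij jl il by auto
  then have "t1 = t2 \<and> t1 = t3"
  proof cases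
    case 1
    have "t1 = t2 \<and> t1 = t3"
      by (rule ap_triangles_ordered[OF A, of t1 n t2 t3 u v w]) (use t mem 1 in simp_all)
    then show ?thesis by blast
  next
    case 2
    have "t3 = t2 \<and> t3 = t1"
      by (rule ap_triangles_ordered[OF A, of t3 n t2 t1 u w v]) (use t mem 2 in simp_all)
    then show ?thesis by blast
  next
    case 3
    have "t1 = t3 \<and> t1 = t2"
      by (rule ap_triangles_ordered[OF A, of t1 n t3 t2 v u w]) (use t mem 3 in simp_all)
    then show ?thesis by blast
  next
    case 4
    have "t3 = t1 \<and> t3 = t2"
      by (rule ap_triangles_ordered[OF A, of t3 n t1 t2 w u v]) (use t mem 4 in simp_all)
    then show ?thesis by blast
  next
    case 5
    have "t2 = t3 \<and> t2 = t1"
      by (rule ap_triangles_ordered[OF A, of t2 n t3 t1 v w u]) (use t mem 5 in simp_all)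
    then show ?thesis by blast
  next
    case 6
    have "t2 = t1 \<and> t2 = t3"
      by (rule ap_triangles_ordered[OF A, of t2 n t1 t3 w v u]) (use t mem 6 in simp_all)
    then show ?thesis by blast
  qed
  then show "t1 = t2" "t1 = t3" by blast+
qed

lemma card_ap_triangles: "card (ap_triangles n A) = n * card A"
proof -
  have "inj_on (\<lambda>(x, a). ap_triangle x a) ({..<n} \<times> A)"
    by (auto simp: inj_on_def)
  then show ?thesis by (simp add: ap_triangles_def card_image card_cartesian_product)
qed

text \<open>The vertex set has three parts of size \<open>3 * n\<close>, large enough for all third terms \<open>x + 2 * a\<close>; hence
  \<open>36 = 4 * 9\<close> and \<open>162 = 2 * 9\<^sup>2\<close>.\<close>

lemma ap_triangles_lower_bound:
  fixes \<epsilon> :: real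
  assumes A: "ap3_free A" "A \<subseteq> {..<n}" and n: "n > 0" and bound: "TFL_bound \<epsilon> M"
  shows "real (card A) \<le> 36 * ln M + 162 * \<epsilon> * real n"
proof -
  define P where "P = {..<3::nat} \<times> {..<3 * n}"
  have "ap_triangles n A \<subseteq> Pow P"
    using A(2) by (fastforce simp: ap_triangles_def ap_triangle_def P_def)
  moreover have "finite P" "P \<noteq> {}" using n by (auto simp: P_def lessThan_empty_iff)
  ultimately have "real (card (ap_triangles n A)) \<le> 4 * real (card P) * ln M + 2 * \<epsilon> * (real (card P))\<^sup>2"
    using rs_system_lower_bound[OF _ _ _ rs_system_ap_triangles[OF A(1)] bound] by blast
  then have "n * real (card A) \<le> n * (36 * ln M + 162 * \<epsilon> * n)"
    by (simp add: card_ap_triangles P_def card_cartesian_product power2_eq_square algebra_simps)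
  then show ?thesis using n by simp
qed

section \<open>The lower bound for the triangle-free lemma\<close>

text \<open>Behrend's set has at least \<open>2 ^ (k * k) / 8 ^ k\<close> elements, and the assumption on \<open>\<epsilon>\<close> makes the
  error term \<open>162 * \<epsilon> * n\<close> at most half of that.\<close>

lemma ln_TFL_bound_ge:
  fixes \<epsilon> :: real
  assumes k: "k \<ge> 8" and eps: "\<epsilon> * 256 ^ k \<le> 1" and bound: "TFL_bound \<epsilon> M"
  shows "2 ^ (k * k) / (72 * 8 ^ k) \<le> ln M"
proof -
  define n :: nat where "n = 2 ^ (k * (k + 1))"
  obtain A where A: "A \<subseteq> {..<n}" "ap3_free A" and size: "2 ^ (k * k) \<le> card A * 8 ^ k"
    using behrend[of k] k unfolding n_def by auto
  have size': "2 ^ (k * k) \<le> card A * (8 ^ k :: real)"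
    using of_nat_mono[OF size, where 'a = real] by simp
  also have "\<dots> \<le> (36 * ln M + 162 * \<epsilon> * n) * 8 ^ k"
    using ap_triangles_lower_bound[OF A(2,1) _ bound] by (intro mult_right_mono) (auto simp: n_def)
  finally have le: "2 ^ (k * k) \<le> 36 * 8 ^ k * ln M + 162 * (\<epsilon> * n * 8 ^ k)"
    by (simp add: algebra_simps)
  have "\<epsilon> * n * 8 ^ k * 16 ^ k = 2 ^ (k * k) * (\<epsilon> * 256 ^ k)"
  proof -
    have "real n * 8 ^ k * 16 ^ k = 2 ^ (k * k) * (2 ^ k * 8 ^ k * 16 ^ k)"
      by (simp add: n_def power_add)
    also have "2 ^ k * 8 ^ k * 16 ^ k = (256 ^ k :: real)"
      by (simp flip: power_mult_distrib)
    finally show ?thesis by (simp add: mult_ac)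
  qed
  also have "\<dots> \<le> 2 ^ (k * k)"
    using mult_left_mono[OF eps, of "2 ^ (k * k)"] by simp
  finally have "\<epsilon> * n * 8 ^ k \<le> 2 ^ (k * k) / 16 ^ k"
    by (simp add: field_simps)
  also have "\<dots> \<le> 2 ^ (k * k) / 324"
  proof (rule divide_left_mono)
    have "(324 :: real) \<le> 16 ^ 8" by simp
    also have "\<dots> \<le> 16 ^ k" using k by (intro power_increasing) auto
    finally show "(324 :: real) \<le> 16 ^ k" .
  qed auto
  finally have "162 * (\<epsilon> * n * 8 ^ k) \<le> 2 ^ (k * k) / 2"
    by (simp add: field_simps)
  with le have "2 ^ (k * k) \<le> 72 * 8 ^ k * ln M" by (simp add: field_simps)
  then show ?thesis by (simp add: field_simps)
qed

text \<open>The 5-cycle has \<open>25\<close> as the square of its order, so an approximate homomorphism loses no edge. A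
  homomorphism to a graph on at most two vertices would be a proper 2-colouring of an odd cycle.\<close>

lemma TFL_bound_ge_3:
  assumes bound: "TFL_bound \<epsilon> M" and eps: "\<epsilon> < 1/25"
  shows "M \<ge> 3"
proof (rule ccontr)
  assume "\<not> M \<ge> 3"
  define V :: "nat set" where "V = {..<5}"
  define E :: "nat set set" where "E = {{0,1},{1,2},{2,3},{3,4},{0,4}}"
  have sg: "simple_graph V E" by (auto simp: simple_graph_def V_def E_def)
  have adjacent: "x = y + 1 \<or> y = x + 1 \<or> x = y + 4 \<or> y = x + 4" if "{x, y} \<in> E" for x y
    using that by (auto simp: E_def doubleton_eq_iff)
  have "triangle_free E"
    unfolding triangle_free_def
  proof (intro notI, elim exE conjE)
    fix x y z assume "{x, y} \<in> E" "{y, z} \<in> E" "{x, z} \<in> E"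
    from this[THEN adjacent] show False by presburger
  qed
  then obtain W :: "nat set" and F \<phi> where W: "simple_graph W F" "card W \<le> M"
    and hom: "approx_hom \<epsilon> V E W F \<phi>"
    using bound sg unfolding TFL_bound_def by blast
  have "real (card {e \<in> E. \<phi> ` e \<notin> F}) \<le> \<epsilon> * 25"
    using hom by (simp add: approx_hom_def V_def)
  then have "card {e \<in> E. \<phi> ` e \<notin> F} = 0" using eps by linarith
  moreover have "finite E" by (simp add: E_def)
  ultimately have FE: "\<phi> ` e \<in> F" if "e \<in> E" for e using that by auto
  have "\<phi> x \<noteq> \<phi> y" if "{x, y} \<in> E" for x y
  proof
    assume "\<phi> x = \<phi> y"
    then have "{\<phi> x} \<in> F" using FE[OF that] by simp
    then show False using W by (auto simp: simple_graph_def)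
  qed
  then have ne: "\<phi> 0 \<noteq> \<phi> 1" "\<phi> 1 \<noteq> \<phi> 2" "\<phi> 2 \<noteq> \<phi> 3" "\<phi> 3 \<noteq> \<phi> 4" "\<phi> 0 \<noteq> \<phi> 4"
    by (auto simp: E_def)
  have two: "a = c" if "a \<in> W" "b \<in> W" "c \<in> W" "a \<noteq> b" "b \<noteq> c" for a b c
  proof (rule ccontr)
    assume "a \<noteq> c"
    then have "card {a, b, c} = 3" using that by simp
    moreover have "card {a, b, c} \<le> card W"
      using that W by (intro card_mono) (auto simp: simple_graph_def)
    ultimately show False using W \<open>\<not> M \<ge> 3\<close> by simp
  qed
  have mem: "\<phi> i \<in> W" if "i < 5" for i using hom that by (auto simp: approx_hom_def V_def)
  have "\<phi> 0 = \<phi> 2" using two[of "\<phi> 0" "\<phi> 1" "\<phi> 2"] mem ne by simp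
  moreover have "\<phi> 2 = \<phi> 4" using two[of "\<phi> 2" "\<phi> 3" "\<phi> 4"] mem ne by simp
  ultimately show False using ne by simp
qed

text \<open>The constant \<open>100000\<close> has to meet two demands. For \<open>ln (1/\<epsilon>) < 64\<close> the left-hand side must not exceed
  \<open>3\<close>, the bound from the 5-cycle, which needs \<open>64\<^sup>2 / 100000\<close> to be below \<open>ln (ln 3)\<close>. For larger values
  \<open>ln_TFL_bound_ge\<close> applies, which would allow a far larger constant.\<close>

lemma TFL_bound_ge_exp:
  assumes bound: "TFL_bound \<epsilon> M" and eps: "0 < \<epsilon>" "\<epsilon> < 1/25"
  shows "exp (exp ((ln (1/\<epsilon>))\<^sup>2 / 100000)) \<le> M"
proof -
  define L where "L = ln (1/\<epsilon>)"
  have M3: "M \<ge> 3" by (rule TFL_bound_ge_3[OF bound eps(2)])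
  have "L > 0" using eps by (simp add: L_def)
  show ?thesis
  proof (cases "L \<ge> 64")
    case True
    \<comment> \<open>The factor \<open>8\<close> is an upper bound for \<open>ln 256\<close>, so that \<open>256 ^ k \<le> 1 / \<epsilon>\<close>.\<close>
    define k where "k = nat \<lfloor>L / 8\<rfloor>"
    have floor: "8 * real k \<le> L" "L < 8 * real k + 8"
    proof -
      have k: "real k = of_int \<lfloor>L / 8\<rfloor>" using \<open>L > 0\<close> by (simp add: k_def)
      have "real k \<le> L / 8" "L / 8 < real k + 1"
        using floor_correct[of "L / 8"] unfolding k of_int_add of_int_1 by blast+
      then show "8 * real k \<le> L" "L < 8 * real k + 8" by simp_all
    qed
    then have k8: "k \<ge> 8" using True unfolding k_def by (simp add: le_nat_iff le_floor_iff)
    have Lk: "L \<le> 9 * real k" using floor k8 by linarith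
    have "256 ^ k = exp (real k * ln 256)" by (simp add: exp_of_nat_mult)
    also have "\<dots> \<le> exp L"
    proof -
      have "ln (256 :: real) = 8 * ln 2"
        using ln_realpow[of "2::real" 8] by simp
      then have "ln (256 :: real) \<le> 8" using ln_2_less_1 by simp
      then have "real k * ln 256 \<le> real k * 8" by (intro mult_left_mono) auto
      then show ?thesis using floor by simp
    qed
    also have "exp L = 1 / \<epsilon>" using eps by (simp add: L_def)
    finally have "\<epsilon> * 256 ^ k \<le> 1" using eps by (simp add: field_simps)
    then have lnM: "2 ^ (k * k) / (72 * 8 ^ k) \<le> ln M"
      by (rule ln_TFL_bound_ge[OF k8 _ bound])
    have "L\<^sup>2 \<le> (9 * real k)\<^sup>2" using Lk \<open>L > 0\<close> by (intro power_mono) auto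
    then have "L\<^sup>2 \<le> 81 * real (k * k)" by (simp add: power2_eq_square)
    moreover have "0 \<le> real (k * k)" by (rule of_nat_0_le_iff)
    ultimately have "L\<^sup>2 \<le> 12500 * real (k * k)" by linarith
    then have "L\<^sup>2 / 100000 \<le> real (k * k) / 8" by simp
    \<comment> \<open>The bound on \<open>ln M\<close> is \<open>2 ^ (k * k) / (72 * 8 ^ k)\<close>; weakening \<open>72\<close> to \<open>2 ^ 7\<close> makes it
      a power of two, whose exponent is at least a quarter of \<open>k * k\<close> once \<open>k \<ge> 8\<close>.\<close>
    also have "\<dots> \<le> (real (k * k) - 3 * k - 7) * ln 2"
    proof -
      have "ln (exp (1/2)) \<le> ln (2 :: real)"
        using exp_half_le2 by (intro ln_mono) auto
      then have ln2: "1/2 \<le> ln (2 :: real)" by simp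
      have "8 * real k \<le> real (k * k)" using k8 by simp
      then have "real (k * k) / 4 \<le> real (k * k) - 3 * k - 7" using k8 by linarith
      then have "real (k * k) / 4 * (1/2) \<le> (real (k * k) - 3 * k - 7) * ln 2"
        using ln2 by (intro mult_mono) auto
      then show ?thesis by simp
    qed
    finally have "exp (L\<^sup>2 / 100000) \<le> exp ((real (k * k) - 3 * k - 7) * ln 2)"
      by simp
    also have "\<dots> = 2 ^ (k * k) / (128 * 8 ^ k)"
    proof -
      have p: "exp (real m * ln 2) = 2 ^ m" for m by (simp add: exp_of_nat_mult)
      have "(real (k * k) - 3 * k - 7) * ln 2 = real (k * k) * ln 2 - (real (3 * k) * ln 2 + real 7 * ln 2)"
        by (simp add: algebra_simps)
      then show ?thesis by (simp only: exp_diff exp_add p) (simp add: power_mult)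
    qed
    also have "\<dots> \<le> 2 ^ (k * k) / (72 * 8 ^ k)"
      by (intro divide_left_mono mult_right_mono) auto
    also have "\<dots> \<le> ln M" by (rule lnM)
    finally have "exp (exp (L\<^sup>2 / 100000)) \<le> exp (ln M)" by simp
    then show ?thesis using M3 by (simp add: L_def)
  next
    case False
    have "L\<^sup>2 \<le> 64\<^sup>2" using False \<open>L > 0\<close> by (intro power_mono) auto
    then have "exp (L\<^sup>2 / 100000) \<le> exp (1/24)" by simp
    also have "\<dots> \<le> 1 + 1/24 + (1/24)\<^sup>2" by (rule exp_bound) auto
    also have "\<dots> \<le> 1 + 1/20" by (simp add: power2_eq_square)
    finally have "exp (exp (L\<^sup>2 / 100000)) \<le> exp (1 + 1/20)" by simp
    \<comment> \<open>The quadratic bound on \<open>exp\<close> is too weak at \<open>1\<close>, but sharp enough at small arguments.\<close>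
    also have "exp (1 + 1/20 :: real) = exp (21/400) ^ 20" by (simp flip: exp_of_nat_mult)
    also have "\<dots> \<le> (1 + 21/400 + (21/400)\<^sup>2) ^ 20"
      by (intro power_mono exp_bound) auto
    also have "\<dots> \<le> 3" by (simp add: power2_eq_square power_divide)
    also have "\<dots> \<le> M" using M3 by simp
    finally show ?thesis by (simp add: L_def)
  qed
qed

theorem corollary1p11:
  "\<exists>c::real. c > 0 \<and>
     (\<forall>\<epsilon>::real. 0 < \<epsilon> \<and> \<epsilon> < 1/25 \<longrightarrow>
        ereal_of_enat (M_TFL \<epsilon>) \<ge> ereal (exp ((1/\<epsilon>) powr (c * ln (1/\<epsilon>)))))"
proof (intro exI conjI allI impI)
  show "(1/100000 :: real) > 0" by simp
  fix \<epsilon> :: real assume eps: "0 < \<epsilon> \<and> \<epsilon> < 1/25"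
  have pow: "(1/\<epsilon>) powr (1/100000 * ln (1/\<epsilon>)) = exp ((ln (1/\<epsilon>))\<^sup>2 / 100000)"
    using eps by (simp add: powr_def power2_eq_square)
  show "ereal_of_enat (M_TFL \<epsilon>) \<ge> ereal (exp ((1/\<epsilon>) powr (1/100000 * ln (1/\<epsilon>))))"
  proof (cases "{M. TFL_bound \<epsilon> M} = {}")
    case True
    then show ?thesis by (simp add: M_TFL_def top_enat_def)
  next
    case False
    \<comment> \<open>The extended naturals are well-ordered, so the infimum is attained.\<close>
    then have "M_TFL \<epsilon> \<in> enat ` {M. TFL_bound \<epsilon> M}"
      unfolding M_TFL_def by (intro wellorder_InfI[of "enat (SOME M. TFL_bound \<epsilon> M)"] imageI) (simp add: some_in_eq[symmetric] someI_ex)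
    then obtain M where "TFL_bound \<epsilon> M" "M_TFL \<epsilon> = enat M" by auto
    then show ?thesis using TFL_bound_ge_exp[of \<epsilon> M] eps by (simp only: pow) simp
  qed
qed

end
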